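(* Assume Chang's Conjecture for $\aleph_\omega$. Let $Y$ be a regular space having a dense set of $P_{\omega_1}$-points. Let $X$ be the space $(Y^{\aleph_\omega}, \tau_{<\omega_1})$. Then $Nt(X) \geq \aleph_2$.
   Context: All topological spaces have at least two points; regular spaces are assumed to be $T_1$. For cardinals $\lambda,\kappa,\mu,\tau$, $(\lambda,\kappa)\twoheadrightarrow(\mu,\tau)$ means that for every structure $(A,B,\dots)$ with countable signature (where $B\subseteq A$ is the interpretation of a unary predicate) such that $|A|=\lambda$ and $|B|=\kappa$, there is an elementary substructure $(A',B',\dots)\prec(A,B,\dots)$ with $|A'|=\mu$ and $|B'|=\tau$. Chang's Conjecture for $\aleph_\omega$ is the assertion $(\aleph_{\omega+1},\aleph_\omega)\twoheadrightarrow(\aleph_1,\aleph_0)$. A point $x\in Y$ is a $P_{\omega_1}$-point if for every family $\mathcal{U}$ of at most $\aleph_1$ many neighbourhoods of $x$, the set $\bigcap\mathcal{U}$ has non-empty interior. $(Y^{\kappa},\tau_{<\omega_1})$ denotes $Y^\kappa$ with the topology generated by the sets $\prod_{\alpha<\kappa}W_\alpha$ with each $W_\alpha$ open in $Y$ and $|\{\alpha<\kappa: W_\alpha\neq Y\}|<\omega_1$. A family $\mathcal{B}$ of sets is $\kappa^{op}$-like (with respect to $\supseteq$) if every bounded subset of $(\mathcal{B},\supseteq)$ has size strictly less than $\kappa$, i.e. for every $B\in\mathcal{B}$, the set $\{C\in\mathcal{B}:B\subseteq C\}$ has cardinality less than $\kappa$. The Noetherian type $Nt(X)$ is the minimum cardinal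 $\kappa$ such that $X$ has a $\kappa^{op}$-like base. *)

theory Defs
  imports "HOL-Analysis.Analysis"
begin

no_notation elt_set_eq (infix "=o" 50)
unbundle cardinal_syntax

section \<open>Cardinals\<close>

text \<open>
  Cardinals are the cardinal orders of the library.  HOL does not prove that some closed type
  has size at least \<open>\<aleph>\<^sub>\<omega>\<close>, so the alephs are predicates on relations over an arbitrary type.  Quantifying
  over relations on the type of \<open>r\<close> loses nothing, since every cardinal below \<open>r\<close> is
  isomorphic to one on that type.
\<close>

primrec is_aleph :: "nat \<Rightarrow> 'a rel \<Rightarrow> bool" where
  "is_aleph 0 r \<longleftrightarrow> r =o natLeq"
| "is_aleph (Suc n) r \<longleftrightarrow> (\<exists>s :: 'a rel. is_aleph n s \<and> r =o cardSuc s)"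

text \<open>\<open>\<aleph>\<^sub>\<omega>\<close> is the least cardinal that is an upper bound of all \<open>\<aleph>\<^sub>n\<close>.\<close>

definition above_alephs :: "'a rel \<Rightarrow> bool" where
  "above_alephs r \<longleftrightarrow> Card_order r \<and> (\<forall>n. \<exists>s :: 'a rel. is_aleph n s \<and> s \<le>o r)"

definition is_aleph_omega :: "'a rel \<Rightarrow> bool" where
  "is_aleph_omega r \<longleftrightarrow> above_alephs r \<and> (\<forall>t :: 'a rel. above_alephs t \<longrightarrow> r \<le>o t)"

abbreviation aleph0 :: "nat rel" where "aleph0 \<equiv> natLeq"
abbreviation aleph1 :: "nat set rel" where "aleph1 \<equiv> cardSuc aleph0"
abbreviation aleph2 :: "nat set set rel" where "aleph2 \<equiv> cardSuc aleph1"

section \<open>First-order structures with countable signature\<close>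

text \<open>
  Symbols are natural numbers, which covers all countable signatures up to renaming.
  Constants are function symbols of arity 0.
\<close>

record signature =
  fun_syms :: "nat set"
  rel_syms :: "nat set"
  fun_arity :: "nat \<Rightarrow> nat"
  rel_arity :: "nat \<Rightarrow> nat"

datatype fo_term = Var nat | App nat "fo_term list"

datatype fo_form =
    Eql fo_term fo_term
  | Atom nat "fo_term list"
  | Neg fo_form
  | Conj fo_form fo_form
  | Exi nat fo_form

fun wf_term :: "signature \<Rightarrow> fo_term \<Rightarrow> bool" where
  "wf_term L (Var x) \<longleftrightarrow> True"
| "wf_term L (App f ts) \<longleftrightarrow>
     f \<in> fun_syms L \<and> length ts = fun_arity L f \<and> (\<forall>t\<in>set ts. wf_term L t)"

fun wf_form :: "signature \<Rightarrow> fo_form \<Rightarrow> bool" where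
  "wf_form L (Eql t u) \<longleftrightarrow> wf_term L t \<and> wf_term L u"
| "wf_form L (Atom p ts) \<longleftrightarrow>
     p \<in> rel_syms L \<and> length ts = rel_arity L p \<and> (\<forall>t\<in>set ts. wf_term L t)"
| "wf_form L (Neg \<phi>) \<longleftrightarrow> wf_form L \<phi>"
| "wf_form L (Conj \<phi> \<psi>) \<longleftrightarrow> wf_form L \<phi> \<and> wf_form L \<psi>"
| "wf_form L (Exi x \<phi>) \<longleftrightarrow> wf_form L \<phi>"

text \<open>
  Only the values of the interpretations on symbols of the signature and on lists of the right
  length over the universe matter.
\<close>

record 'a fo_struct =
  universe :: "'a set"
  fun_interp :: "nat \<Rightarrow> 'a list \<Rightarrow> 'a"
  rel_interp :: "nat \<Rightarrow> 'a list \<Rightarrow> bool"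

definition is_structure :: "signature \<Rightarrow> 'a fo_struct \<Rightarrow> bool" where
  "is_structure L M \<longleftrightarrow>
     universe M \<noteq> {} \<and>
     (\<forall>f\<in>fun_syms L. \<forall>as\<in>lists (universe M).
        length as = fun_arity L f \<longrightarrow> fun_interp M f as \<in> universe M)"

primrec eval_term :: "'a fo_struct \<Rightarrow> (nat \<Rightarrow> 'a) \<Rightarrow> fo_term \<Rightarrow> 'a" where
  "eval_term M v (Var x) = v x"
| "eval_term M v (App f ts) = fun_interp M f (map (eval_term M v) ts)"

primrec sat :: "'a fo_struct \<Rightarrow> (nat \<Rightarrow> 'a) \<Rightarrow> fo_form \<Rightarrow> bool" where
  "sat M v (Eql t u) \<longleftrightarrow> eval_term M v t = eval_term M v u"
| "sat M v (Atom p ts) \<longleftrightarrow> rel_interp M p (map (eval_term M v) ts)"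
| "sat M v (Neg \<phi>) \<longleftrightarrow> \<not> sat M v \<phi>"
| "sat M v (Conj \<phi> \<psi>) \<longleftrightarrow> sat M v \<phi> \<and> sat M v \<psi>"
| "sat M v (Exi x \<phi>) \<longleftrightarrow> (\<exists>a\<in>universe M. sat M (v(x := a)) \<phi>)"

definition substructure :: "signature \<Rightarrow> 'a fo_struct \<Rightarrow> 'a fo_struct \<Rightarrow> bool" where
  "substructure L N M \<longleftrightarrow>
     is_structure L N \<and> universe N \<subseteq> universe M \<and>
     (\<forall>f\<in>fun_syms L. \<forall>as\<in>lists (universe N).
        length as = fun_arity L f \<longrightarrow> fun_interp N f as = fun_interp M f as) \<and>
     (\<forall>p\<in>rel_syms L. \<forall>as\<in>lists (universe N).
        length as = rel_arity L p \<longrightarrow> rel_interp N p as = rel_interp M p as)"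

definition elementary_substructure :: "signature \<Rightarrow> 'a fo_struct \<Rightarrow> 'a fo_struct \<Rightarrow> bool" where
  "elementary_substructure L N M \<longleftrightarrow>
     substructure L N M \<and>
     (\<forall>\<phi> v. wf_form L \<phi> \<longrightarrow> range v \<subseteq> universe N \<longrightarrow> (sat N v \<phi> \<longleftrightarrow> sat M v \<phi>))"

definition unary_part :: "'a fo_struct \<Rightarrow> nat \<Rightarrow> 'a set" where
  "unary_part M p = {a \<in> universe M. rel_interp M p [a]}"

text \<open>
  The relation \<open>(\<lambda>,\<kappa>) \<Zsurj> (\<mu>,\<tau>)\<close>.  Structures live on the type of the cardinal \<open>\<lambda>\<close>; as the
  field of \<open>\<lambda>\<close> is itself a set of size \<open>\<lambda>\<close>, every structure of size \<open>\<lambda>\<close> has an isomorphic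
  copy there.
\<close>

definition chang :: "'a rel \<Rightarrow> 'b rel \<Rightarrow> 'c rel \<Rightarrow> 'd rel \<Rightarrow> bool" where
  "chang lam kap mu tau \<longleftrightarrow>
     (\<forall>L p. \<forall>M :: 'a fo_struct.
        is_structure L M \<and> p \<in> rel_syms L \<and> rel_arity L p = 1 \<and>
        |universe M| =o lam \<and> |unary_part M p| =o kap \<longrightarrow>
        (\<exists>N. elementary_substructure L N M \<and>
             |universe N| =o mu \<and> |unary_part N p| =o tau))"

text \<open>For \<open>al\<close> of cardinality \<open>\<aleph>\<^sub>\<omega>\<close> this is Chang's Conjecture for \<open>\<aleph>\<^sub>\<omega>\<close>.\<close>

definition chang_conjecture_for :: "'a rel \<Rightarrow> bool" where
  "chang_conjecture_for al \<longleftrightarrow> chang (cardSuc al) al aleph1 aleph0"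

section \<open>Topological notions\<close>

text \<open>A \<open>P\<close>-point for families of at most \<open>kap\<close> many (not necessarily open) neighbourhoods.\<close>

definition P_point :: "'c rel \<Rightarrow> 'a topology \<Rightarrow> 'a \<Rightarrow> bool" where
  "P_point kap Y x \<longleftrightarrow> x \<in> topspace Y \<and>
     (\<forall>\<U>. (\<forall>N\<in>\<U>. N \<subseteq> topspace Y \<and> x \<in> Y interior_of N) \<and> |\<U>| \<le>o kap \<longrightarrow>
          Y interior_of (topspace Y \<inter> \<Inter>\<U>) \<noteq> {})"

text \<open>
  The power \<open>Y\<^sup>I\<close> with supports of size less than \<open>kap\<close>; as for \<^const>\<open>product_topology\<close>, its
  points are the extensional functions on \<open>I\<close>.
\<close>

definition power_topology :: "'c rel \<Rightarrow> 'i set \<Rightarrow> 'a topology \<Rightarrow> ('i \<Rightarrow> 'a) topology" where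
  "power_topology kap I Y = topology_generated_by
     {Pi\<^sub>E I W | W. (\<forall>i\<in>I. openin Y (W i)) \<and> |{i \<in> I. W i \<noteq> topspace Y}| <o kap}"

definition base_of :: "'a topology \<Rightarrow> 'a set set \<Rightarrow> bool" where
  "base_of X \<B> \<longleftrightarrow> (\<forall>B\<in>\<B>. openin X B) \<and>
     (\<forall>U x. openin X U \<and> x \<in> U \<longrightarrow> (\<exists>B\<in>\<B>. x \<in> B \<and> B \<subseteq> U))"

definition op_like :: "'c rel \<Rightarrow> 'a set set \<Rightarrow> bool" where
  "op_like kap \<B> \<longleftrightarrow> (\<forall>B\<in>\<B>. |{C \<in> \<B>. B \<subseteq> C}| <o kap)"

text \<open>
  \<open>Nt(X)\<close>, as a cardinal order determined up to isomorphism.  The lemmas below show that such a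
  least cardinal exists and that it is least among the cardinals over all types.
\<close>

definition noetherian_type :: "'a topology \<Rightarrow> 'a set set rel" where
  "noetherian_type X = (SOME r. Card_order r \<and> (\<exists>\<B>. base_of X \<B> \<and> op_like r \<B>) \<and>
     (\<forall>s :: 'a set set rel. Card_order s \<and> (\<exists>\<B>. base_of X \<B> \<and> op_like s \<B>) \<longrightarrow> r \<le>o s))"

lemma opens_op_like:
  "base_of X {U. openin X U}" "op_like (cardSuc |{U. openin X U}| ) {U. openin X U}"
proof -
  show "base_of X {U. openin X U}"
    unfolding base_of_def by blast
  have "|{C \<in> {U. openin X U}. B \<subseteq> C}| <o cardSuc |{U. openin X U}|" for B
    by (rule ordLeq_ordLess_trans[OF card_of_mono1 cardSuc_greater[OF card_of_Card_order]]) (rule Collect_restrict)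
  then show "op_like (cardSuc |{U. openin X U}| ) {U. openin X U}"
    unfolding op_like_def by simp
qed

lemma noetherian_type:
  fixes X :: "'a topology"
  shows "Card_order (noetherian_type X)" (is ?A)
    and "\<exists>\<B>. base_of X \<B> \<and> op_like (noetherian_type X) \<B>" (is ?B)
    and noetherian_type_least_aux:
      "\<forall>s :: 'a set set rel. Card_order s \<and> (\<exists>\<B>. base_of X \<B> \<and> op_like s \<B>) \<longrightarrow>
         noetherian_type X \<le>o s" (is ?C)
proof -
  let ?P = "\<lambda>r :: 'a set set rel. Card_order r \<and> (\<exists>\<B>. base_of X \<B> \<and> op_like r \<B>)"
  have "?P (cardSuc |{U. openin X U}| )"
    by (intro conjI exI[of _ "{U. openin X U}"] opens_op_like cardSuc_Card_order card_of_Card_order)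
  then have "\<exists>r\<in>Collect ?P. \<forall>s\<in>Collect ?P. r \<le>o s"
    by (intro exists_minim_Card_order) (simp_all only: Collect_empty_eq mem_Collect_eq, blast+)
  then have "\<exists>r. ?P r \<and> (\<forall>s. ?P s \<longrightarrow> r \<le>o s)"
    by (simp only: Bex_def Ball_def mem_Collect_eq)
  then have "?P (noetherian_type X) \<and> (\<forall>s. ?P s \<longrightarrow> noetherian_type X \<le>o s)"
    unfolding noetherian_type_def conj_assoc[symmetric] by (rule someI_ex)
  then show ?A ?B ?C by - (elim conjE, assumption | intro conjI)+
qed

lemma noetherian_type_least:
  fixes X :: "'a topology" and s :: "'c rel"
  assumes s: "Card_order s" and B: "base_of X \<B>" "op_like s \<B>"
  shows "noetherian_type X \<le>o s"
proof -
  let ?S = "cardSuc |{U. openin X U}|"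
  have S: "Card_order ?S" by (rule cardSuc_Card_order[OF card_of_Card_order])
  have *: "noetherian_type X \<le>o t" if "Card_order t" "base_of X \<C>" "op_like t \<C>"
      for t :: "'a set set rel" and \<C>
    by (rule noetherian_type_least_aux[rule_format], intro conjI exI[of _ \<C>]) (fact that)+
  have "Well_order s" "Well_order ?S" using s S by (simp_all only: card_order_on_def)
  then consider "?S \<le>o s" | "s \<le>o ?S" using ordLeq_total by metis
  then show ?thesis
  proof cases
    case 1
    show ?thesis by (rule ordLeq_transitive[OF *[OF S opens_op_like] 1])
  next
    case 2
    then obtain t :: "'a set set rel" where t: "s =o t" using internalize_ordLeq[of s ?S] by auto
    have "op_like t \<B>"
      unfolding op_like_def
      by (rule ballI, rule ordLess_ordIso_trans[OF _ t]) (rule B(2)[unfolded op_like_def, rule_format])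
    from *[OF Card_order_ordIso2[OF s t] B(1) this]
    show ?thesis by (rule ordLeq_ordIso_trans[OF _ ordIso_symmetric[OF t]])
  qed
qed

end

theory Submission
  imports Defs "HOL-Library.Countable_Set_Type"
begin

text \<open>
  Fix a point \<open>x\<close> of the power all of whose coordinates are one \<open>P\<close>-point \<open>d\<close>.  Every base contains more
  than \<open>\<aleph>\<^sub>\<omega>\<close> neighbourhoods of \<open>x\<close>, because no family of \<open>\<aleph>\<^sub>\<omega>\<close> countable sets is cofinal
  among the countable subsets of \<open>\<aleph>\<^sub>\<omega>\<close> and each basic neighbourhood has a countable support.
  Chang's Conjecture, applied to functions enumerating these supports, yields \<open>\<aleph>\<^sub>1\<close> many members
  of the base with supports inside one countable set.  As \<open>d\<close> is a \<open>P\<close>-point, these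
  \<open>\<aleph>\<^sub>1\<close> many members have a common nonempty open subset, hence a common subset in the base.
\<close>

section \<open>The alephs, countable subsets of aleph_omega, and Chang's Conjecture\<close>

lemma is_aleph_Card_order: "is_aleph n (r :: 'a rel) \<Longrightarrow> Card_order r"
proof (induction n arbitrary: r)
  case 0
  then have "r =o natLeq" by simp
  then show ?case by (rule Card_order_ordIso[OF natLeq_Card_order])
next
  case (Suc n)
  then obtain s :: "'a rel" where s: "is_aleph n s" "r =o cardSuc s" by auto
  show ?case
    by (rule Card_order_ordIso[OF cardSuc_Card_order[OF Suc.IH[OF s(1)]] s(2)])
qed

lemma is_aleph_unique: "is_aleph n (r :: 'a rel) \<Longrightarrow> is_aleph n (s :: 'b rel) \<Longrightarrow> r =o s"
proof (induction n arbitrary: r s)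
  case 0
  then have "r =o natLeq" "s =o natLeq" by simp_all
  then show ?case by (rule ordIso_transitive[OF _ ordIso_symmetric])
next
  case (Suc n)
  from Suc.prems(1) obtain r' :: "'a rel" where r': "is_aleph n r'" "r =o cardSuc r'" by auto
  from Suc.prems(2) obtain s' :: "'b rel" where s': "is_aleph n s'" "s =o cardSuc s'" by auto
  have "cardSuc r' =o cardSuc s'"
    by (rule cardSuc_invar_ordIso[THEN iffD2, OF is_aleph_Card_order[OF r'(1)]
          is_aleph_Card_order[OF s'(1)] Suc.IH[OF r'(1) s'(1)]])
  then show ?case
    by (rule ordIso_transitive[OF r'(2) ordIso_transitive[OF _ ordIso_symmetric[OF s'(2)]]])
qed

lemma is_aleph_infinite: "is_aleph n (r :: 'a rel) \<Longrightarrow> natLeq \<le>o r"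
proof (induction n arbitrary: r)
  case 0
  then have "r =o natLeq" by simp
  then show ?case by (rule ordIso_imp_ordLeq[OF ordIso_symmetric])
next
  case (Suc n)
  then obtain s :: "'a rel" where s: "is_aleph n s" "r =o cardSuc s" by auto
  have "natLeq \<le>o cardSuc s"
    by (rule ordLeq_transitive[OF Suc.IH[OF s(1)] cardSuc_ordLeq[OF is_aleph_Card_order[OF s(1)]]])
  then show ?case by (rule ordLeq_ordIso_trans[OF _ ordIso_symmetric[OF s(2)]])
qed

text \<open>Strictness comes from going one aleph further: \<open>r\<close> also bounds the next
  aleph, which is the successor of a cardinal isomorphic to \<open>s\<close>.\<close>

lemma above_alephs_less:
  assumes "above_alephs (r :: 'a rel)" "is_aleph n (s :: 'a rel)"
  shows "s <o r"
proof -
  obtain t :: "'a rel" where t: "is_aleph (Suc n) t" "t \<le>o r"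
    using assms(1) unfolding above_alephs_def by blast
  then obtain s' :: "'a rel" where s': "is_aleph n s'" "t =o cardSuc s'" by auto
  have "s =o s'" by (rule is_aleph_unique[OF assms(2) s'(1)])
  moreover have "s' <o cardSuc s'"
    by (rule cardSuc_greater[OF is_aleph_Card_order[OF s'(1)]])
  moreover have "cardSuc s' \<le>o r"
    by (rule ordIso_ordLeq_trans[OF ordIso_symmetric[OF s'(2)] t(2)])
  ultimately show ?thesis
    by (rule ordLess_ordLeq_trans[OF ordIso_ordLess_trans])
qed

text \<open>This is the countable cofinality of aleph_omega, obtained from its minimality: a union
  of subsets of \<open>K\<close> realising all the alephs is itself above all of them, so it is at
  least as large as \<open>K\<close>. The union is equinumerous with \<open>K\<close> but need not
  equal it.\<close>

lemma aleph_omega_decomposition: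
  fixes K :: "'k set"
  assumes "is_aleph_omega |K|"
  obtains A :: "nat \<Rightarrow> 'k set"
  where "\<And>n. infinite (A n)" "\<And>n. |A n| <o |K|" "|\<Union>n. A n| =o |K|"
proof -
  have K: "above_alephs |K|" and least: "\<And>t :: 'k rel. above_alephs t \<Longrightarrow> |K| \<le>o t"
    using assms unfolding is_aleph_omega_def by blast+
  have "\<exists>s :: 'k rel. is_aleph n s \<and> s \<le>o |K|" for n
    using K unfolding above_alephs_def by blast
  then obtain s :: "nat \<Rightarrow> 'k rel" where s: "\<And>n. is_aleph n (s n)" "\<And>n. s n \<le>o |K|"
    by metis
  \<comment> \<open>The field of \<open>s n\<close> may lie outside \<open>K\<close>. Being no
    larger than \<open>K\<close>, it can be replaced by a subset of \<open>K\<close>.\<close>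
  have "\<exists>B \<subseteq> K. s n =o |B|" for n
  proof -
    have F: "|Field (s n)| =o s n"
      by (rule card_of_Field_ordIso[OF is_aleph_Card_order[OF s(1)]])
    then have "|Field (s n)| \<le>o |K|" using s(2) by (rule ordIso_ordLeq_trans)
    then obtain B where B: "B \<subseteq> K" "|Field (s n)| =o |B|"
      unfolding internalize_card_of_ordLeq2[of "Field (s n)"] by blast
    from ordIso_transitive[OF ordIso_symmetric[OF F] B(2)] B(1) show ?thesis by blast
  qed
  then obtain A where A: "\<And>n. A n \<subseteq> K" "\<And>n. s n =o |A n|"
    by metis
  have "above_alephs |\<Union>n. A n|"
    unfolding above_alephs_def
  proof (intro conjI allI)
    fix n
    have "|A n| \<le>o |\<Union>n. A n|" by (rule card_of_mono1) blast
    from ordIso_ordLeq_trans[OF A(2) this] s(1)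
    show "\<exists>s' :: 'k rel. is_aleph n s' \<and> s' \<le>o |\<Union>n. A n|" by blast
  qed (rule card_of_Card_order)
  then have "|K| \<le>o |\<Union>n. A n|" by (rule least)
  moreover have "|\<Union>n. A n| \<le>o |K|" by (rule card_of_mono1) (use A(1) in blast)
  ultimately have "|\<Union>n. A n| =o |K|" unfolding ordIso_iff_ordLeq by (rule conjI[rotated])
  moreover have "infinite (A n)" for n
    using ordLeq_ordIso_trans[OF is_aleph_infinite[OF s(1)] A(2)]
      infinite_iff_natLeq_ordLeq[of "A n"] by blast
  moreover have "|A n| <o |K|" for n
    by (rule ordIso_ordLess_trans[OF ordIso_symmetric[OF A(2)] above_alephs_less[OF K s(1)]])
  ultimately show thesis by (intro that)
qed

lemma aleph_omega_infinite:
  assumes "is_aleph_omega |K|"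
  shows "infinite K"
proof -
  obtain A :: "nat \<Rightarrow> 'a set" where A: "infinite (A 0)" "|\<Union>n. A n| =o |K|"
    by (rule aleph_omega_decomposition[OF assms]) blast
  have "infinite (\<Union>n. A n)" by (rule infinite_super[OF _ A(1)]) blast
  then show ?thesis using card_of_ordIso_finite[OF A(2)] by blast
qed

text \<open>A diagonal argument along the decomposition of aleph_omega: an injection
  \<open>e\<close> splits \<open>F\<close> into countably many pieces smaller than \<open>K\<close>,
  one point of \<open>K\<close> escapes all sets of a given piece, and \<open>T\<close> collects
  these points.\<close>

lemma countable_sets_not_cofinal:
  fixes K :: "'k set" and F :: "'c set"
  assumes K: "is_aleph_omega |K|" and F: "|F| \<le>o |K|"
    and c: "\<And>c. c \<in> F \<Longrightarrow> countable (S c)"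
  obtains T where "T \<subseteq> K" "countable T" "\<forall>c\<in>F. \<not> T \<subseteq> S c"
proof -
  obtain A :: "nat \<Rightarrow> 'k set"
    where A: "\<And>n. infinite (A n)" "\<And>n. |A n| <o |K|" "|\<Union>n. A n| =o |K|"
    by (rule aleph_omega_decomposition[OF K]) blast
  have "|F| \<le>o |\<Union>n. A n|"
    by (rule ordLeq_ordIso_trans[OF F ordIso_symmetric[OF A(3)]])
  then obtain e where e: "inj_on e F" "e ` F \<subseteq> (\<Union>n. A n)"
    unfolding card_of_ordLeq[symmetric] by blast
  \<comment> \<open>Otherwise \<open>K\<close> would be covered by at most |A n| many countable
    sets. As \<open>A n\<close> is infinite, their union has size at most |A n|, which is less than
    |K|.\<close>
  have "\<exists>k \<in> K. \<forall>c\<in>F. e c \<in> A n \<longrightarrow> k \<notin> S c" for n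
  proof (rule ccontr)
    let ?F = "{c \<in> F. e c \<in> A n}"
    assume "\<not> ?thesis"
    then have "K \<subseteq> (\<Union>c\<in>?F. S c)" by blast
    then have "|K| \<le>o |\<Union>c\<in>?F. S c|" by (rule card_of_mono1)
    moreover have "|\<Union>c\<in>?F. S c| \<le>o |A n|"
    proof (rule card_of_UNION_ordLeq_infinite[OF A(1)])
      have "inj_on e ?F" "e ` ?F \<subseteq> A n"
        using e(1) by (auto simp: inj_on_def)
      then show "|?F| \<le>o |A n|" unfolding card_of_ordLeq[symmetric] by blast
      show "\<forall>c\<in>?F. |S c| \<le>o |A n|"
      proof
        fix c assume "c \<in> ?F"
        then have "|S c| \<le>o natLeq"
          using assms(3) by (simp add: countable_card_le_natLeq)
        moreover have "natLeq \<le>o |A n|"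
          using A(1)[of n] infinite_iff_natLeq_ordLeq[of "A n"] by blast
        ultimately show "|S c| \<le>o |A n|" by (rule ordLeq_transitive)
      qed
    qed
    ultimately have "|K| \<le>o |A n|" by (rule ordLeq_transitive)
    then show False by (rule not_ordLess_ordLeq[OF A(2), THEN notE])
  qed
  then obtain k where k: "\<And>n. k n \<in> K" "\<And>n c. c \<in> F \<Longrightarrow> e c \<in> A n \<Longrightarrow> k n \<notin> S c"
    by metis
  show thesis
  proof (rule that[of "range k"])
    show "range k \<subseteq> K" using k(1) by blast
    show "\<forall>c\<in>F. \<not> range k \<subseteq> S c"
    proof
      fix c assume "c \<in> F"
      then obtain n where "e c \<in> A n" using e(2) by blast
      with k(2)[OF \<open>c \<in> F\<close>] show "\<not> range k \<subseteq> S c" by blast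
    qed
  qed simp
qed

text \<open>Chang's Conjecture as a closure statement. \<open>E\<close> becomes a structure whose
  predicate is the copy of \<open>K\<close> under \<open>e\<close> and whose \<open>n\<close>-th
  function sends \<open>a\<close> to the copy of \<open>s a n\<close>. The universe \<open>H\<close>
  of the elementary substructure is closed under these functions, so all \<open>s a n\<close> with
  \<open>a\<close> in \<open>H\<close> have their copies in its countable predicate part.\<close>

lemma chang_closed_subset:
  fixes lam :: "'e rel" and E :: "'e set" and e :: "'k \<Rightarrow> 'e" and s :: "'e \<Rightarrow> nat \<Rightarrow> 'k"
  assumes chang: "chang lam |K| mu natLeq"
    and E: "|E| =o lam" "E \<noteq> {}"
    and e: "inj_on e K" "e ` K \<subseteq> E"
    and s: "\<And>a n. a \<in> E \<Longrightarrow> s a n \<in> K"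
  obtains H I where "H \<subseteq> E" "|H| =o mu" "I \<subseteq> K" "countable I" "\<forall>a\<in>H. \<forall>n. s a n \<in> I"
proof -
  \<comment> \<open>One unary function symbol for each natural number: a countable signature thus
    encodes the whole sequence \<open>s a\<close>. All argument lists have length one, so
    \<open>hd\<close> reads off the argument.\<close>
  define L where "L = \<lparr>fun_syms = UNIV, rel_syms = {0}, fun_arity = \<lambda>_. 1, rel_arity = \<lambda>_. 1\<rparr>"
  define M where "M = \<lparr>universe = E, fun_interp = \<lambda>n as. e (s (hd as) n),
    rel_interp = \<lambda>_ as. hd as \<in> e ` K\<rparr>"
  have "is_structure L M"
    using E(2) e(2) s unfolding is_structure_def L_def M_def image_subset_iff
    by (auto simp: length_Suc_conv)
  moreover have "unary_part M 0 = e ` K"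
    using e(2) by (auto simp: unary_part_def M_def)
  moreover have "|e ` K| =o |K|"
    by (rule ordIso_symmetric)
      (unfold card_of_ordIso[symmetric], use inj_on_imp_bij_betw[OF e(1)] in blast)
  ultimately obtain N where N: "elementary_substructure L N M"
    "|universe N| =o mu" "|unary_part N 0| =o natLeq"
    using chang[unfolded chang_def, rule_format, of L M 0] E(1)
    by (auto simp: L_def M_def)
  have sub: "universe N \<subseteq> E"
    and cl: "\<And>a n. a \<in> universe N \<Longrightarrow> e (s a n) \<in> universe N"
    and part: "\<And>a. a \<in> universe N \<Longrightarrow> rel_interp N 0 [a] \<longleftrightarrow> a \<in> e ` K"
  proof -
    have *: "substructure L N M" using N(1) by (simp add: elementary_substructure_def)
    show "universe N \<subseteq> E" using * by (simp add: substructure_def M_def)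
    show "rel_interp N 0 [a] \<longleftrightarrow> a \<in> e ` K" if "a \<in> universe N" for a
    proof -
      have "[a] \<in> lists (universe N)" using that by simp
      then show ?thesis using * by (auto simp: substructure_def M_def L_def)
    qed
    show "e (s a n) \<in> universe N" if "a \<in> universe N" for a n
    proof -
      have l: "[a] \<in> lists (universe N)" using that by simp
      then have "fun_interp N n [a] = fun_interp M n [a]"
        using * by (simp add: substructure_def L_def)
      then have "fun_interp N n [a] = e (s a n)" by (simp add: M_def)
      moreover have "fun_interp N n [a] \<in> universe N"
      proof -
        have "is_structure L N" using * by (simp add: substructure_def)
        then show ?thesis using l by (simp add: is_structure_def L_def)
      qed
      ultimately show ?thesis by simp
    qed
  qed
  \<comment> \<open>Pulls the predicate part back to \<open>K\<close>; injectivity of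
    \<open>e\<close> transfers countability.\<close>
  let ?I = "{i \<in> K. e i \<in> universe N}"
  have "countable (unary_part N 0)"
    unfolding countable_card_le_natLeq by (rule ordIso_imp_ordLeq[OF N(3)])
  moreover have "e ` ?I \<subseteq> unary_part N 0"
    using part by (auto simp: unary_part_def)
  ultimately have "countable (e ` ?I)" by (rule countable_subset[rotated])
  then have "countable ?I"
    by (rule countable_image_inj_on) (use e(1) in \<open>auto simp: inj_on_def\<close>)
  moreover have "\<forall>a\<in>universe N. \<forall>n. s a n \<in> ?I" using sub cl s by blast
  ultimately show thesis by (intro that[of "universe N" ?I] sub N(2)) simp_all
qed

section \<open>Boxes with countable support\<close>

lemma ordLess_aleph1_iff: "|A| <o aleph1 \<longleftrightarrow> countable A"
  by (simp only: countable_card_le_natLeq cardSuc_ordLeq_ordLess[OF natLeq_Card_order card_of_Card_order])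

lemma openin_power_topology_box:
  assumes "\<And>i. i \<in> I \<Longrightarrow> openin Y (W i)" "countable {i \<in> I. W i \<noteq> topspace Y}"
  shows "openin (power_topology aleph1 I Y) (Pi\<^sub>E I W)"
  unfolding power_topology_def
  by (rule topology_generated_by_Basis) (use assms in \<open>auto simp: ordLess_aleph1_iff\<close>)

text \<open>The generating boxes form a base: they are closed under binary intersection, because the
  supports of two boxes unite to a countable set. The proof is an induction on how \<open>U\<close>
  is generated.\<close>

lemma power_topology_box_nhd:
  assumes "openin (power_topology aleph1 I Y) U" "x \<in> U"
  obtains W where "\<forall>i\<in>I. openin Y (W i)" "countable {i \<in> I. W i \<noteq> topspace Y}"
    "x \<in> Pi\<^sub>E I W" "Pi\<^sub>E I W \<subseteq> U"
proof -
  let ?S = "{Pi\<^sub>E I W | W. (\<forall>i\<in>I. openin Y (W i)) \<and> |{i \<in> I. W i \<noteq> topspace Y}| <o aleph1}"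
  have "generate_topology_on ?S U"
    using assms(1) unfolding power_topology_def openin_topology_generated_by_iff .
  then have "\<exists>W. (\<forall>i\<in>I. openin Y (W i)) \<and> countable {i \<in> I. W i \<noteq> topspace Y} \<and>
      x \<in> Pi\<^sub>E I W \<and> Pi\<^sub>E I W \<subseteq> U"
    using assms(2)
  proof (induction rule: generate_topology_on.induct)
    case Empty
    then show ?case by simp
  next
    case (Int a b)
    then have "x \<in> a" "x \<in> b" by simp_all
    from Int.IH(1)[OF this(1)] obtain V where
      V: "\<forall>i\<in>I. openin Y (V i)" "countable {i \<in> I. V i \<noteq> topspace Y}" "x \<in> Pi\<^sub>E I V" "Pi\<^sub>E I V \<subseteq> a"
      by (elim exE conjE)
    from Int.IH(2)[OF \<open>x \<in> b\<close>] obtain W where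
      W: "\<forall>i\<in>I. openin Y (W i)" "countable {i \<in> I. W i \<noteq> topspace Y}" "x \<in> Pi\<^sub>E I W" "Pi\<^sub>E I W \<subseteq> b"
      by (elim exE conjE)
    have "{i \<in> I. V i \<inter> W i \<noteq> topspace Y}
        \<subseteq> {i \<in> I. V i \<noteq> topspace Y} \<union> {i \<in> I. W i \<noteq> topspace Y}" by blast
    then have "countable {i \<in> I. V i \<inter> W i \<noteq> topspace Y}"
      by (rule countable_subset) (use V(2) W(2) in simp)
    moreover have "Pi\<^sub>E I (\<lambda>i. V i \<inter> W i) = Pi\<^sub>E I V \<inter> Pi\<^sub>E I W" by (rule PiE_Int[symmetric])
    moreover have "\<forall>i\<in>I. openin Y (V i \<inter> W i)" using V(1) W(1) by (simp add: openin_Int)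
    ultimately show ?case
      using V(3,4) W(3,4) by (intro exI[of _ "\<lambda>i. V i \<inter> W i"]) (simp add: le_infI1 le_infI2)
  next
    case (UN k)
    then obtain c where c: "c \<in> k" "x \<in> c" by blast
    from UN.IH[OF this] obtain W where W: "\<forall>i\<in>I. openin Y (W i)"
      "countable {i \<in> I. W i \<noteq> topspace Y}" "x \<in> Pi\<^sub>E I W" "Pi\<^sub>E I W \<subseteq> c" by (elim exE conjE)
    have "Pi\<^sub>E I W \<subseteq> \<Union>k" using W(4) c(1) by (rule order_trans[OF _ Union_upper])
    with W show ?case by (intro exI[of _ W] conjI)
  next
    case (Basis s)
    then obtain W where "s = Pi\<^sub>E I W" "\<forall>i\<in>I. openin Y (W i)" "|{i \<in> I. W i \<noteq> topspace Y}| <o aleph1"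
      by blast
    with Basis.prems show ?case
      by (intro exI[of _ W]) (simp add: ordLess_aleph1_iff)
  qed
  then show thesis by (elim exE conjE) (rule that)
qed

text \<open>With at most |K| members of the base around the constant point, a box inside each would
  give at most |K| countable supports, and some countable \<open>T\<close> lies in none of them.
  Constraining the coordinates in \<open>T\<close> to the proper neighbourhood \<open>U\<close>
  defines a neighbourhood of the point that contains none of these members.\<close>

lemma base_at_constant_large:
  fixes K :: "'k set" and Y :: "'y topology"
  assumes K: "is_aleph_omega |K|"
    and d: "d \<in> topspace Y" "openin Y U" "d \<in> U" "U \<noteq> topspace Y"
    and B: "base_of (power_topology aleph1 K Y) \<B>"
  shows "|K| <o |{C \<in> \<B>. (\<lambda>i\<in>K. d) \<in> C}|"
proof (rule ccontr)
  let ?x = "\<lambda>i\<in>K. d" and ?X = "power_topology aleph1 K Y"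
  let ?F = "{C \<in> \<B>. ?x \<in> C}"
  assume "\<not> ?thesis"
  then have F: "|?F| \<le>o |K|"
    unfolding not_ordLess_iff_ordLeq[OF card_of_Well_order card_of_Well_order] .
  let ?box = "\<lambda>C W. (\<forall>i\<in>K. openin Y (W i)) \<and> countable {i \<in> K. W i \<noteq> topspace Y} \<and>
      ?x \<in> Pi\<^sub>E K W \<and> Pi\<^sub>E K W \<subseteq> C"
  have "\<exists>W. ?box C W" if "C \<in> ?F" for C
  proof -
    have "openin ?X C" "?x \<in> C" using that B by (simp_all add: base_of_def)
    then obtain W where "\<forall>i\<in>K. openin Y (W i)" "countable {i \<in> K. W i \<noteq> topspace Y}"
      "?x \<in> Pi\<^sub>E K W" "Pi\<^sub>E K W \<subseteq> C" by (rule power_topology_box_nhd)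
    then show ?thesis by (intro exI[of _ W] conjI)
  qed
  then have "\<forall>C\<in>?F. \<exists>W. ?box C W" by (rule ballI)
  from bchoice[OF this] obtain W where "\<forall>C\<in>?F. ?box C (W C)" by (rule exE)
  then have
    W: "\<And>C. C \<in> ?F \<Longrightarrow> countable {i \<in> K. W C i \<noteq> topspace Y}"
      "\<And>C. C \<in> ?F \<Longrightarrow> ?x \<in> Pi\<^sub>E K (W C)" "\<And>C. C \<in> ?F \<Longrightarrow> Pi\<^sub>E K (W C) \<subseteq> C"
    by (simp_all only: Ball_def)
  obtain T where T: "T \<subseteq> K" "countable T"
    "\<forall>C\<in>?F. \<not> T \<subseteq> {i \<in> K. W C i \<noteq> topspace Y}"
    by (rule countable_sets_not_cofinal[OF K F W(1)])
  let ?V = "\<lambda>i. if i \<in> T then U else topspace Y"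
  have "openin ?X (Pi\<^sub>E K ?V)"
  proof (rule openin_power_topology_box)
    show "countable {i \<in> K. ?V i \<noteq> topspace Y}"
      by (rule countable_subset[OF _ T(2)]) auto
  qed (use d(2) in auto)
  moreover have "?x \<in> Pi\<^sub>E K ?V" using d by auto
  ultimately have "\<exists>C\<in>\<B>. ?x \<in> C \<and> C \<subseteq> Pi\<^sub>E K ?V"
    using B unfolding base_of_def by (elim conjE allE impE) (rule conjI)
  then obtain C where C: "C \<in> ?F" "C \<subseteq> Pi\<^sub>E K ?V" by auto
  have "Pi\<^sub>E K (W C) \<subseteq> Pi\<^sub>E K ?V"
    using W(3)[OF C(1)] C(2) by (rule subset_trans)
  \<comment> \<open>Inclusion of boxes can be read off coordinatewise only if the smaller box is
    nonempty; it contains the constant point.\<close>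
  moreover have "Pi\<^sub>E K (W C) \<noteq> {}" using W(2)[OF C(1)] by blast
  ultimately have "\<forall>i\<in>K. W C i \<subseteq> ?V i"
    unfolding subset_PiE by - (elim disjE, erule (1) notE, assumption)
  then have sub: "W C i \<subseteq> ?V i" if "i \<in> K" for i
    using that by (rule bspec)
  have "T \<subseteq> {i \<in> K. W C i \<noteq> topspace Y}"
  proof
    fix i assume "i \<in> T"
    then have "i \<in> K" "W C i \<subseteq> U" using T(1) sub[of i] by auto
    with openin_subset[OF d(2)] d(4) show "i \<in> {i \<in> K. W C i \<noteq> topspace Y}" by blast
  qed
  with bspec[OF T(3) C(1)] show False ..
qed

text \<open>The boxes are intersected coordinatewise. On \<open>I\<close> the \<open>P\<close>-point
  \<open>d\<close> makes the interior of the intersection nonempty; outside \<open>I\<close> every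
  factor is the whole space, so the support stays countable and the product is open. The interiors
  may omit \<open>d\<close>, hence \<open>V\<close> is only claimed to be nonempty.\<close>

lemma P_point_boxes_common_subset:
  assumes d: "P_point kap Y d" and H: "|H| \<le>o kap" and I: "I \<subseteq> K" "countable I"
    and W: "\<And>a i. a \<in> H \<Longrightarrow> i \<in> K \<Longrightarrow> openin Y (W a i)"
      "\<And>a i. a \<in> H \<Longrightarrow> i \<in> K \<Longrightarrow> d \<in> W a i"
      "\<And>a i. a \<in> H \<Longrightarrow> i \<in> K - I \<Longrightarrow> W a i = topspace Y"
  obtains V where "openin (power_topology aleph1 K Y) V" "V \<noteq> {}"
    "\<forall>a\<in>H. V \<subseteq> Pi\<^sub>E K (W a)"
proof -
  define V where "V i = (if i \<in> I then Y interior_of (topspace Y \<inter> (\<Inter>a\<in>H. W a i)) else topspace Y)"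
    for i
  have "V i \<noteq> {}" for i
  proof (cases "i \<in> I")
    case True
    let ?U = "(\<lambda>a. W a i) ` H"
    have "|?U| \<le>o kap"
      by (rule ordLeq_transitive[OF card_of_image H])
    moreover have "\<forall>N\<in>?U. N \<subseteq> topspace Y \<and> d \<in> Y interior_of N"
    proof
      fix N assume "N \<in> ?U"
      then have "openin Y N" "d \<in> N" using W(1,2) I(1) True by auto
      then show "N \<subseteq> topspace Y \<and> d \<in> Y interior_of N"
        using openin_subset[of Y N] by (simp add: interior_of_openin)
    qed
    ultimately have "Y interior_of (topspace Y \<inter> \<Inter>?U) \<noteq> {}"
      using d unfolding P_point_def by simp
    then show ?thesis using True by (simp add: V_def)
  next
    case False
    then show ?thesis using d by (auto simp: V_def P_point_def)
  qed
  then have "Pi\<^sub>E K V \<noteq> {}" by (simp add: PiE_eq_empty_iff)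
  moreover have "openin (power_topology aleph1 K Y) (Pi\<^sub>E K V)"
  proof (rule openin_power_topology_box)
    show "countable {i \<in> K. V i \<noteq> topspace Y}"
      by (rule countable_subset[OF _ I(2)]) (auto simp: V_def)
  qed (simp add: V_def)
  moreover have "\<forall>a\<in>H. Pi\<^sub>E K V \<subseteq> Pi\<^sub>E K (W a)"
  proof (intro ballI PiE_mono)
    fix a i assume "a \<in> H" "i \<in> K"
    then show "V i \<subseteq> W a i"
      using W(3)[of a i] interior_of_subset[of Y "topspace Y \<inter> (\<Inter>a\<in>H. W a i)"]
      by (auto simp: V_def)
  qed
  ultimately show thesis by (intro that)
qed

section \<open>The lower bound for the Noetherian type\<close>

theorem theorem3p4:
  fixes K :: "'k set" and Y :: "'y topology"
  assumes "is_aleph_omega |K|"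
    and "chang_conjecture_for |K|"
    and "regular_space Y" and "t1_space Y"
    and "\<exists>x\<in>topspace Y. \<exists>y\<in>topspace Y. x \<noteq> y"
    and "\<exists>D. D \<subseteq> {x. P_point aleph1 Y x} \<and> Y closure_of D = topspace Y"
  shows "aleph2 \<le>o noetherian_type (power_topology aleph1 K Y)"
proof (rule ccontr)
  let ?X = "power_topology aleph1 K Y"
  let ?E = "Field (cardSuc |K| )"
  assume neg: "\<not> ?thesis"
  have al1: "Card_order aleph1" by (rule cardSuc_Card_order[OF natLeq_Card_order])
  have "noetherian_type ?X <o aleph2"
    using neg not_ordLeq_iff_ordLess[of "noetherian_type ?X" aleph2]
      noetherian_type(1)[of ?X] cardSuc_Card_order[OF al1] by (simp add: card_order_on_def)
  \<comment> \<open>Hence each member of the base \<open>\<B>\<close> chosen below has only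
    countably many supersets in \<open>\<B>\<close>. This is what will be contradicted.\<close>
  then have Nt: "noetherian_type ?X \<le>o aleph1"
    by (rule cardSuc_ordLeq_ordLess[OF al1 noetherian_type(1), THEN iffD1])
  obtain \<B> where B: "base_of ?X \<B>" "op_like (noetherian_type ?X) \<B>"
    using noetherian_type(2) by blast
  obtain d where d: "P_point aleph1 Y d"
  proof -
    obtain D where D: "D \<subseteq> {x. P_point aleph1 Y x}" "Y closure_of D = topspace Y"
      using assms(6) by blast
    then have "D \<noteq> {}" using assms(5) by auto
    then show thesis using D(1) that by blast
  qed
  then have dY: "d \<in> topspace Y" by (simp add: P_point_def)
  obtain y where y: "y \<in> topspace Y" "y \<noteq> d" using assms(5) by metis
  let ?x = "\<lambda>i\<in>K. d"
  let ?F = "{C \<in> \<B>. ?x \<in> C}"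
  \<comment> \<open>Since \<open>Y\<close> is T1, removing a second point yields a proper open
    neighbourhood of \<open>d\<close>.\<close>
  have "openin Y (topspace Y - {y})"
    using assms(4) y(1) by (simp add: t1_space_openin_delete_alt)
  then have "|K| <o |?F|"
    by (rule base_at_constant_large[OF assms(1) dY _ _ _ B(1)]) (use y dY in auto)
  then have "cardSuc |K| \<le>o |?F|"
    by (rule cardSuc_least[OF card_of_Card_order card_of_Card_order])
  moreover have E: "|?E| =o cardSuc |K|"
    by (rule card_of_Field_ordIso[OF cardSuc_Card_order[OF card_of_Card_order]])
  ultimately have "|?E| \<le>o |?F|" by (rule ordIso_ordLeq_trans[rotated])
  \<comment> \<open>\<open>g\<close> indexes distinct base members around the constant point by a
    set of size aleph_(omega+1), the universe to which Chang's Conjecture will be applied.\<close>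
  then obtain g where g: "inj_on g ?E" "g ` ?E \<subseteq> ?F"
    unfolding card_of_ordLeq[symmetric] by blast
  have "|K| \<le>o |?E|"
    by (rule ordLeq_ordIso_trans[OF cardSuc_ordLeq[OF card_of_Card_order] ordIso_symmetric[OF E]])
  then obtain e where e: "inj_on e K" "e ` K \<subseteq> ?E"
    unfolding card_of_ordLeq[symmetric] by blast
  \<comment> \<open>A box may have empty support, which no sequence enumerates; adding
    \<open>k0\<close> makes the enumerated set nonempty.\<close>
  obtain k0 where k0: "k0 \<in> K"
    using infinite_imp_nonempty[OF aleph_omega_infinite[OF assms(1)]] by blast
  \<comment> \<open>A box and an enumeration of a countable set containing its support are chosen
    together, as a pair.\<close>
  let ?box = "\<lambda>a (W, s :: nat \<Rightarrow> 'k). (\<forall>i\<in>K. openin Y (W i) \<and> d \<in> W i) \<and>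
    Pi\<^sub>E K W \<subseteq> g a \<and> range s \<subseteq> K \<and> {i \<in> K. W i \<noteq> topspace Y} \<subseteq> range s"
  have "\<exists>Ws. ?box a Ws" if "a \<in> ?E" for a
  proof -
    have "g a \<in> ?F" using that g(2) by blast
    then have "openin ?X (g a)" "?x \<in> g a" using B(1) by (simp_all add: base_of_def)
    then obtain W where W: "\<forall>i\<in>K. openin Y (W i)"
      "countable {i \<in> K. W i \<noteq> topspace Y}" "?x \<in> Pi\<^sub>E K W" "Pi\<^sub>E K W \<subseteq> g a"
      by (rule power_topology_box_nhd)
    let ?s = "from_nat_into (insert k0 {i \<in> K. W i \<noteq> topspace Y})"
    have "range ?s = insert k0 {i \<in> K. W i \<noteq> topspace Y}"
      by (rule range_from_nat_into) (use W(2) in auto)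
    moreover have "\<forall>i\<in>K. d \<in> W i" using W(3) by (auto simp: PiE_iff)
    ultimately show ?thesis
      using W(1,4) k0 by (intro exI[of _ "(W, ?s)"]) auto
  qed
  then have "\<forall>a\<in>?E. \<exists>Ws. ?box a Ws" by (rule ballI)
  from bchoice[OF this] obtain Ws where Ws: "\<forall>a\<in>?E. ?box a (Ws a)" by (rule exE)
  define W s where "W a = fst (Ws a)" and "s a = snd (Ws a)" for a
  have
    W: "\<And>a i. a \<in> ?E \<Longrightarrow> i \<in> K \<Longrightarrow> openin Y (W a i)"
      "\<And>a i. a \<in> ?E \<Longrightarrow> i \<in> K \<Longrightarrow> d \<in> W a i" "\<And>a. a \<in> ?E \<Longrightarrow> Pi\<^sub>E K (W a) \<subseteq> g a"
    and s: "\<And>a. a \<in> ?E \<Longrightarrow> range (s a :: nat \<Rightarrow> 'k) \<subseteq> K"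
      "\<And>a. a \<in> ?E \<Longrightarrow> {i \<in> K. W a i \<noteq> topspace Y} \<subseteq> range (s a)"
    using Ws unfolding W_def s_def by (simp_all add: case_prod_beta)
  have sK: "s a n \<in> K" if "a \<in> ?E" for a n using s(1)[OF that] by blast
  have "?E \<noteq> {}" using e(2) k0 by blast
  \<comment> \<open>Each support lies in the range of \<open>s a\<close>, so the boxes of aleph_1
    many indices are supported in the single countable set \<open>I\<close>.\<close>
  obtain H I where H: "H \<subseteq> ?E" "|H| =o aleph1"
    and I: "I \<subseteq> K" "countable I" "\<forall>a\<in>H. \<forall>n. s a n \<in> I"
    by (rule chang_closed_subset[OF assms(2)[unfolded chang_conjecture_for_def] E \<open>?E \<noteq> {}\<close> e sK])
  obtain V where V: "openin ?X V" "V \<noteq> {}" "\<forall>a\<in>H. V \<subseteq> Pi\<^sub>E K (W a)"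
  proof (rule P_point_boxes_common_subset[OF d ordIso_imp_ordLeq[OF H(2)] I(1,2), of W])
    fix a i assume a: "a \<in> H"
    then have aE: "a \<in> ?E" using H(1) by blast
    show "i \<in> K \<Longrightarrow> openin Y (W a i)" "i \<in> K \<Longrightarrow> d \<in> W a i" using W(1,2)[OF aE] by blast+
    show "i \<in> K - I \<Longrightarrow> W a i = topspace Y" using s(2)[OF aE] bspec[OF I(3) a] by blast
  qed
  obtain z where "z \<in> V" using V(2) by blast
  with V(1) B(1) obtain C where C: "C \<in> \<B>" "C \<subseteq> V"
    unfolding base_of_def by meson
  \<comment> \<open>\<open>C\<close> lies below every \<open>g a\<close> with \<open>a\<close> in
    \<open>H\<close>. Since \<open>g\<close> is injective, it has at least aleph_1 many supersets in
    the base.\<close>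
  have "g ` H \<subseteq> {C' \<in> \<B>. C \<subseteq> C'}"
  proof (rule image_subsetI)
    fix a assume a: "a \<in> H"
    then have "a \<in> ?E" using H(1) by blast
    then have "g a \<in> \<B>" "Pi\<^sub>E K (W a) \<subseteq> g a" using g(2) W(3) by blast+
    with bspec[OF V(3) a] C(2) show "g a \<in> {C' \<in> \<B>. C \<subseteq> C'}" by blast
  qed
  moreover have "inj_on g H" using g(1) H(1) by (rule inj_on_subset)
  ultimately have le: "|H| \<le>o |{C' \<in> \<B>. C \<subseteq> C'}|"
    unfolding card_of_ordLeq[symmetric] by blast
  have "|{C' \<in> \<B>. C \<subseteq> C'}| <o noetherian_type ?X"
    using B(2) C(1) unfolding op_like_def by blast
  then have "|H| <o aleph1"
    by (rule ordLess_ordLeq_trans[OF ordLeq_ordLess_trans[OF le] Nt])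
  then show False by (rule not_ordLess_ordIso[THEN notE, OF _ H(2)])
qed

end
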